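(* The standard module $V$ becomes a $U_{q^{1/2}}(\mathfrak{sl}_2)$-module on which the equitable generators $\mathcal X,\mathcal Y,\mathcal Y^{-1},\mathcal Z$ act as follows: \[ \mathcal X\mapsto (q-1)q^{-N/2}A_-,\quad \mathcal Y\mapsto q^{N/2}A^*,\quad \mathcal Y^{-1}\mapsto q^{-N/2}(A^* )^{-1},\quad \mathcal Z\mapsto (q-1)q^{-N/2}A_+ . \]
   Context: Let $q$ be a prime power, $GF(q)$ the field with $q$ elements, $N\ge 1$ an integer, and $\mathbf V$ an $N$-dimensional vector space over $GF(q)$. Let $X$ be the set of all subspaces of $\mathbf V$, ordered by inclusion (the projective geometry $L_N(q)$). For $y,z\in X$, $y$ covers $z$ means $z\subseteq y$ and $\dim y-\dim z=1$. ${\rm Mat}_X(\mathbb C)$ is the algebra of complex matrices with rows and columns indexed by $X$; it acts on the standard module $V=\mathbb C^X$ by left multiplication. $A^*\in{\rm Mat}_X(\mathbb C)$ is the diagonal matrix with $(y,y)$-entry $q^{-\dim y}$. $R,L\in{\rm Mat}_X(\mathbb C)$: $R_{y,z}=1$ if $y$ covers $z$ and $0$ otherwise; $L_{y,z}=1$ if $z$ covers $y$ and $0$ otherwise. Fix a real number $\varphi>0$ and define \[ A_+=\frac{(A^* )^{-1}}{q-1}+\varphi^{-1}R,\qquad A_-=\frac{(A^* )^{-1}}{q-1}-\varphi (A^* )^{-1}L . \] $U_{q^{1/2}}(\mathfrak{sl}_2)$ in the equitable presentation is the associative unital $\mathbb C$-algebra with generators $\mathcal X,\mathcal Y,\mathcal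 Y^{-1},\mathcal Z$ and relations $\mathcal Y\mathcal Y^{-1}=\mathcal Y^{-1}\mathcal Y=1$, \[ \frac{q\mathcal X\mathcal Y-\mathcal Y\mathcal X}{q-1}=1,\qquad \frac{q\mathcal Y\mathcal Z-\mathcal Z\mathcal Y}{q-1}=1,\qquad \frac{q\mathcal Z\mathcal X-\mathcal X\mathcal Z}{q-1}=1 . \] *)

theory Defs
  imports
    Complex_Main
    "HOL-Library.Cardinality"
    "HOL-Algebra.QuotRing"
    "HOL-Algebra.Module"
    "HOL-Algebra.Algebraic_Closure_Type"
    "HOL-Library.Poly_Mapping"
    "HOL-Number_Theory.Prime_Powers"
begin

subsection \<open>Free algebras over the complex numbers\<close>

text \<open>
  A copy of the lists as a type of its own, so that the free monoid can be written additively,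
  as the convolution product of \<^theory>\<open>HOL-Library.Poly_Mapping\<close> requires.
\<close>

datatype 'g free_word = Word (letters: "'g list")

instantiation free_word :: (type) monoid_add
begin

definition zero_free_word :: "'a free_word" where
  "0 = Word []"

definition plus_free_word :: "'a free_word \<Rightarrow> 'a free_word \<Rightarrow> 'a free_word" where
  "u + v = Word (letters u @ letters v)"

instance
  by standard (simp_all add: zero_free_word_def plus_free_word_def)

end

text \<open>
  Finitely supported functions on words: noncommutative polynomials in the letters of type
  \<open>'g\<close>, a ring with the convolution product.
\<close>

type_synonym 'g free_alg = "'g free_word \<Rightarrow>\<^sub>0 complex"

definition free_const :: "complex \<Rightarrow> 'g free_alg" where
  "free_const c = Poly_Mapping.single 0 c"

definition free_var :: "'g \<Rightarrow> 'g free_alg" where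
  "free_var g = Poly_Mapping.single (Word [g]) 1"

abbreviation free_ring :: "'g free_alg ring" where
  "free_ring \<equiv> ring_of_type_algebra"


subsection \<open>Algebras given by generators and relations\<close>

text \<open>
  The free algebra modulo the two-sided ideal generated by \<open>S\<close>; the elements of \<open>S\<close> are the
  differences of the two sides of the defining relations. The record type \<^type>\<open>module\<close> carries
  the ring together with the scalar multiplication by complex numbers; the locale
  \<open>algebra\<close> of the library is not used because it is restricted to commutative rings.
\<close>

definition presented_algebra :: "'g free_alg set \<Rightarrow> (complex, 'g free_alg set) module" where
  "presented_algebra S =
    (let I = Idl\<^bsub>free_ring\<^esub> S; Q = free_ring Quot I in
      \<lparr> carrier = carrier Q, monoid.mult = monoid.mult Q, one = one Q,
        ring.zero = ring.zero Q, add = add Q,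
        module.smult = (\<lambda>c u. (I +>\<^bsub>free_ring\<^esub> free_const c) \<otimes>\<^bsub>Q\<^esub> u) \<rparr>)"

definition presented_gen :: "'g free_alg set \<Rightarrow> 'g \<Rightarrow> 'g free_alg set" where
  "presented_gen S g = (Idl\<^bsub>free_ring\<^esub> S) +>\<^bsub>free_ring\<^esub> free_var g"


subsection \<open>The equitable presentation\<close>

datatype equitable_gen = GX | GY | GYinv | GZ

definition equitable_relators :: "complex \<Rightarrow> equitable_gen free_alg set" where
  "equitable_relators q =
    (let x = free_var GX; y = free_var GY; y' = free_var GYinv; z = free_var GZ;
         qcomm = (\<lambda>a b. free_const (1 / (q - 1)) * (free_const q * a * b - b * a))
     in {y * y' - 1, y' * y - 1, qcomm x y - 1, qcomm y z - 1, qcomm z x - 1})"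

text \<open>
  \<open>Uq_sl2 q\<close> is the algebra with quantum parameter the square root of \<open>q\<close>; the relations
  only involve \<open>q\<close> itself.
\<close>

definition Uq_sl2 :: "complex \<Rightarrow> (complex, equitable_gen free_alg set) module" where
  "Uq_sl2 q = presented_algebra (equitable_relators q)"

definition Uq_gen :: "complex \<Rightarrow> equitable_gen \<Rightarrow> equitable_gen free_alg set" where
  "Uq_gen q = presented_gen (equitable_relators q)"


subsection \<open>Modules over a complex algebra\<close>

text \<open>
  A left module structure on a complex vector space \<open>V\<close> of functions (with pointwise operations)
  over a not necessarily commutative complex algebra \<open>U\<close>, compatible with the given scalar
  multiplication on \<open>V\<close>: the action is complex-linear both in \<open>U\<close> and in \<open>V\<close>.
\<close>

locale algebra_module =
  fixes U :: "(complex, 'u) module" (structure)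
    and V :: "('x \<Rightarrow> complex) set"
    and act :: "'u \<Rightarrow> ('x \<Rightarrow> complex) \<Rightarrow> 'x \<Rightarrow> complex"
  assumes act_closed: "\<lbrakk>a \<in> carrier U; v \<in> V\<rbrakk> \<Longrightarrow> act a v \<in> V"
    and act_one: "v \<in> V \<Longrightarrow> act \<one> v = v"
    and act_mult: "\<lbrakk>a \<in> carrier U; b \<in> carrier U; v \<in> V\<rbrakk> \<Longrightarrow> act (a \<otimes> b) v = act a (act b v)"
    and act_add_left: "\<lbrakk>a \<in> carrier U; b \<in> carrier U; v \<in> V\<rbrakk> \<Longrightarrow>
          act (a \<oplus> b) v = (\<lambda>x. act a v x + act b v x)"
    and act_add_right: "\<lbrakk>a \<in> carrier U; v \<in> V; w \<in> V\<rbrakk> \<Longrightarrow>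
          act a (\<lambda>x. v x + w x) = (\<lambda>x. act a v x + act a w x)"
    and act_smult_right: "\<lbrakk>a \<in> carrier U; v \<in> V\<rbrakk> \<Longrightarrow>
          act a (\<lambda>x. c * v x) = (\<lambda>x. c * act a v x)"
    and act_smult_left: "\<lbrakk>a \<in> carrier U; v \<in> V\<rbrakk> \<Longrightarrow>
          act (c \<odot> a) v = (\<lambda>x. c * act a v x)"


subsection \<open>Matrices and vectors indexed by a finite set\<close>

text \<open>
  The index set \<open>Xs\<close> depends on a term, so vectors and matrices are functions on the ambient type
  that vanish outside of \<open>Xs\<close>.
\<close>

type_synonym 'x cmat = "'x \<Rightarrow> 'x \<Rightarrow> complex"

definition mat_on :: "'x set \<Rightarrow> 'x cmat \<Rightarrow> 'x cmat" where
  "mat_on Xs f = (\<lambda>y z. if y \<in> Xs \<and> z \<in> Xs then f y z else 0)"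

definition Mat :: "'x set \<Rightarrow> (complex, 'x cmat) module" where
  "Mat Xs =
    \<lparr> carrier = {M. \<forall>y z. y \<notin> Xs \<or> z \<notin> Xs \<longrightarrow> M y z = 0},
      monoid.mult = (\<lambda>M M' y z. \<Sum>w\<in>Xs. M y w * M' w z),
      one = mat_on Xs (\<lambda>y z. if y = z then 1 else 0),
      ring.zero = (\<lambda>y z. 0),
      add = (\<lambda>M M' y z. M y z + M' y z),
      module.smult = (\<lambda>c M y z. c * M y z) \<rparr>"

definition standard_module :: "'x set \<Rightarrow> ('x \<Rightarrow> complex) set" where
  "standard_module Xs = {v. \<forall>y. y \<notin> Xs \<longrightarrow> v y = 0}"

definition mat_vec :: "'x set \<Rightarrow> 'x cmat \<Rightarrow> ('x \<Rightarrow> complex) \<Rightarrow> 'x \<Rightarrow> complex" where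
  "mat_vec Xs M v = (\<lambda>y. \<Sum>z\<in>Xs. M y z * v z)"


subsection \<open>The projective geometry of a vector space\<close>

text \<open>
  Vector spaces are given by their scalar multiplication \<open>smul\<close>. The ground field is the
  type \<open>'k\<close>, and \<^term>\<open>CARD('k)\<close> is its number of elements \<open>q\<close>.
\<close>

definition subspaces :: "('k::{field,finite} \<Rightarrow> 'v::ab_group_add \<Rightarrow> 'v) \<Rightarrow> 'v set set" where
  "subspaces smul = {W. module.subspace smul W}"

definition covers :: "('k::{field,finite} \<Rightarrow> 'v::ab_group_add \<Rightarrow> 'v) \<Rightarrow> 'v set \<Rightarrow> 'v set \<Rightarrow> bool" where
  "covers smul y z \<longleftrightarrow>
    z \<subseteq> y \<and> int (vector_space.dim smul y) - int (vector_space.dim smul z) = 1"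

definition Astar :: "('k::{field,finite} \<Rightarrow> 'v::ab_group_add \<Rightarrow> 'v) \<Rightarrow> 'v set cmat" where
  "Astar smul = mat_on (subspaces smul)
    (\<lambda>y z. if y = z then of_nat CARD('k) powi (- int (vector_space.dim smul y)) else 0)"

definition Rmat :: "('k::{field,finite} \<Rightarrow> 'v::ab_group_add \<Rightarrow> 'v) \<Rightarrow> 'v set cmat" where
  "Rmat smul = mat_on (subspaces smul) (\<lambda>y z. if covers smul y z then 1 else 0)"

definition Lmat :: "('k::{field,finite} \<Rightarrow> 'v::ab_group_add \<Rightarrow> 'v) \<Rightarrow> 'v set cmat" where
  "Lmat smul = mat_on (subspaces smul) (\<lambda>y z. if covers smul z y then 1 else 0)"

definition Aplus :: "('k::{field,finite} \<Rightarrow> 'v::ab_group_add \<Rightarrow> 'v) \<Rightarrow> real \<Rightarrow> 'v set cmat" where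
  "Aplus smul \<phi> =
    (let M = Mat (subspaces smul) in
      (1 / (of_nat CARD('k) - 1)) \<odot>\<^bsub>M\<^esub> (inv\<^bsub>M\<^esub> (Astar smul))
      \<oplus>\<^bsub>M\<^esub> (of_real (inverse \<phi>) \<odot>\<^bsub>M\<^esub> Rmat smul))"

definition Aminus :: "('k::{field,finite} \<Rightarrow> 'v::ab_group_add \<Rightarrow> 'v) \<Rightarrow> real \<Rightarrow> 'v set cmat" where
  "Aminus smul \<phi> =
    (let M = Mat (subspaces smul) in
      ((1 / (of_nat CARD('k) - 1)) \<odot>\<^bsub>M\<^esub> (inv\<^bsub>M\<^esub> (Astar smul)))
      \<ominus>\<^bsub>M\<^esub> (of_real \<phi> \<odot>\<^bsub>M\<^esub> ((inv\<^bsub>M\<^esub> (Astar smul)) \<otimes>\<^bsub>M\<^esub> Lmat smul)))"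

end

(*
  A family of operators satisfying the relators defines a module over the presented algebra, so the
  three q-commutator relations have to be checked on C^X. The two that involve Y only use that R and
  L shift the dimension by one. In the third one, all terms cancel except a multiple of LR - RL,
  and this commutator is diagonal: two distinct subspaces have equally many common covers and common
  cocovers (the sum, respectively the intersection, or none at all), so that the entry at y is the
  number of covers minus the number of hyperplanes of y, (q^(N - dim y) - q^(dim y)) / (q - 1).
*)
theory Submission
  imports Defs
begin


subsection \<open>Evaluation of noncommutative polynomials\<close>

text \<open>Updating at a key outside the support is the same as adding a monomial. In this form the
  induction step fits additive maps such as \<open>ev\<close>.\<close>

lemma poly_mapping_sum_induct [case_names zero add]:
  fixes p :: "'a \<Rightarrow>\<^sub>0 'b::comm_monoid_add"
  assumes "P 0" and "\<And>k c p. P p \<Longrightarrow> P (Poly_Mapping.single k c + p)"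
  shows "P p"
proof (induction p rule: update_induct)
  case const
  then show ?case using assms(1) .
next
  case (update p k c)
  have "Poly_Mapping.update k c p = Poly_Mapping.single k c + p"
    using update(1)
    by (intro poly_mapping_eqI)
      (auto simp: lookup_update lookup_add lookup_single when_def in_keys_iff)
  with update assms(2) show ?case by simp
qed

text \<open>The operators act on all functions; the subspace \<open>V\<close> that becomes a module
  enters only when the relations are imposed.\<close>

locale linear_operators =
  fixes T :: "'g \<Rightarrow> ('x \<Rightarrow> complex) \<Rightarrow> 'x \<Rightarrow> complex"
  assumes T_add: "T g (\<lambda>x. v x + w x) = (\<lambda>x. T g v x + T g w x)"
    and T_scale: "T g (\<lambda>x. c * v x) = (\<lambda>x. c * T g v x)"
begin

definition word_act :: "'g free_word \<Rightarrow> ('x \<Rightarrow> complex) \<Rightarrow> 'x \<Rightarrow> complex" where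
  "word_act w = foldr T (letters w)"

text \<open>The evaluation homomorphism of the free algebra that sends each letter \<open>g\<close>
  to the operator \<open>T g\<close>. The last letter of a word acts first, so products become
  compositions.\<close>

definition ev :: "'g free_alg \<Rightarrow> ('x \<Rightarrow> complex) \<Rightarrow> 'x \<Rightarrow> complex" where
  "ev p v = (\<lambda>x. \<Sum>w\<in>Poly_Mapping.keys p. Poly_Mapping.lookup p w * word_act w v x)"

lemma word_act_0 [simp]: "word_act 0 v = v"
  by (simp add: word_act_def zero_free_word_def)

lemma word_act_plus: "word_act (u + w) v = word_act u (word_act w v)"
  by (simp add: word_act_def plus_free_word_def)

lemma word_act_add: "word_act u (\<lambda>x. v x + w x) = (\<lambda>x. word_act u v x + word_act u w x)"
proof -
  have "foldr T l (\<lambda>x. v x + w x) = (\<lambda>x. foldr T l v x + foldr T l w x)" for l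
    by (induction l) (simp_all add: T_add)
  then show ?thesis by (simp add: word_act_def)
qed

lemma word_act_scale: "word_act u (\<lambda>x. c * v x) = (\<lambda>x. c * word_act u v x)"
proof -
  have "foldr T l (\<lambda>x. c * v x) = (\<lambda>x. c * foldr T l v x)" for l
    by (induction l) (simp_all add: T_scale)
  then show ?thesis by (simp add: word_act_def)
qed

lemma ev_0 [simp]: "ev 0 v = (\<lambda>x. 0)"
  by (simp add: ev_def)

lemma ev_plus: "ev (p + r) v = (\<lambda>x. ev p v x + ev r v x)"
  unfolding ev_def
  by (rule ext, rule setsum_keys_plus_distrib) (simp_all add: distrib_right)

lemma ev_single: "ev (Poly_Mapping.single w c) v = (\<lambda>x. c * word_act w v x)"
  by (auto simp: ev_def)

lemma ev_add: "ev p (\<lambda>x. v x + w x) = (\<lambda>x. ev p v x + ev p w x)"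
  by (simp add: ev_def word_act_add distrib_left sum.distrib)

lemma ev_scale: "ev p (\<lambda>x. c * v x) = (\<lambda>x. c * ev p v x)"
  by (simp add: ev_def word_act_scale sum_distrib_left mult.left_commute)

text \<open>Both sides are additive in \<open>p\<close> and in \<open>r\<close>, so two inductions
  reduce the claim to monomials, where concatenation of words is composition of operators.\<close>

lemma ev_times: "ev (p * r) v = ev p (ev r v)"
proof (induction p rule: poly_mapping_sum_induct)
  case zero
  then show ?case by simp
next
  case (add k c p)
  have "ev (Poly_Mapping.single k c * r) v = ev (Poly_Mapping.single k c) (ev r v)"
  proof (induction r rule: poly_mapping_sum_induct)
    case zero
    then show ?case using ev_scale[of _ 0 "\<lambda>_. 0"] by simp
  next
    case (add l d r)
    then show ?case
      by (simp add: distrib_left ev_plus ev_add mult_single ev_single word_act_plus word_act_scale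
          mult.assoc)
  qed
  with add show ?case by (simp add: distrib_right ev_plus)
qed

lemma ev_one: "ev 1 v = v"
  by (simp add: ev_single flip: single_one)

lemma ev_const: "ev (free_const c) v = (\<lambda>x. c * v x)"
  by (simp add: free_const_def ev_single)

lemma ev_var: "ev (free_var g) v = T g v"
  by (simp add: free_var_def ev_single word_act_def)

lemma ev_uminus: "ev (- p) v = (\<lambda>x. - ev p v x)"
  using ev_plus[of p "- p" v] by (auto simp: fun_eq_iff add_eq_0_iff2)

lemma ev_minus: "ev (p - r) v = (\<lambda>x. ev p v x - ev r v x)"
  using ev_plus[of p "- r" v] by (simp add: ev_uminus)

end

lemma ring_free_ring: "ring (free_ring :: 'g free_alg ring)"
proof -
  have "\<exists>y. x + y = 0" for x :: "'g free_alg"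
    using add.right_inverse by blast
  then show ?thesis
    unfolding ring_of_type_algebra_def
    by unfold_locales (auto simp: algebra_simps Units_def)
qed

text \<open>Operators that satisfy the relations on \<open>V\<close> kill the ideal generated by the relators there,
  so that they define a module over the quotient.\<close>

theorem (in linear_operators) presented_algebra_module:
  assumes V_add: "\<And>v w. v \<in> V \<Longrightarrow> w \<in> V \<Longrightarrow> (\<lambda>x. v x + w x) \<in> V"
    and V_scale: "\<And>c v. v \<in> V \<Longrightarrow> (\<lambda>x. c * v x) \<in> V"
    and V_T: "\<And>g v. v \<in> V \<Longrightarrow> T g v \<in> V"
    and relators: "\<And>s v. s \<in> S \<Longrightarrow> v \<in> V \<Longrightarrow> ev s v = (\<lambda>x. 0)"
  shows "\<exists>act. algebra_module (presented_algebra S) V act \<and>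
    (\<forall>g. \<forall>v\<in>V. act (presented_gen S g) v = T g v)"
proof -
  define R :: "'g free_alg ring" where "R = free_ring"
  define I where "I = Idl\<^bsub>R\<^esub> S"
  interpret R: ring R
    unfolding R_def by (rule ring_free_ring)
  have R_simps: "carrier R = UNIV" "\<zero>\<^bsub>R\<^esub> = 0" "\<one>\<^bsub>R\<^esub> = 1"
      "a \<otimes>\<^bsub>R\<^esub> b = a * b" "a \<oplus>\<^bsub>R\<^esub> b = a + b" for a b
    by (simp_all add: R_def ring_of_type_algebra_def)
  interpret I: ideal I R
    unfolding I_def by (rule R.genideal_ideal) (simp add: R_simps)
  have ev_closed: "ev p v \<in> V" if "v \<in> V" for p v
  proof (induction p rule: poly_mapping_sum_induct)
    case zero
    then show ?case using V_scale[OF that, of 0] by simp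
  next
    case (add k c p)
    have "foldr T l v \<in> V" for l
      by (induction l) (auto intro: that V_T)
    then show ?case using add
      by (auto simp: ev_plus ev_single word_act_def intro!: V_add V_scale)
  qed
  \<comment> \<open>The annihilator of \<open>V\<close> in the free algebra. It is closed under
    multiplication from the right because \<open>V\<close> is stable under every
    \<open>ev p\<close>.\<close>
  define J where "J = {p. \<forall>v\<in>V. ev p v = (\<lambda>x. 0)}"
  have ev_null: "ev p (\<lambda>x. 0) = (\<lambda>x. 0)" for p
    using ev_scale[of p 0 "\<lambda>_. 0"] by simp
  have "ideal J R"
  proof (rule idealI)
    show "subgroup J (add_monoid R)"
    proof (rule R.add.subgroupI)
      fix a assume a: "a \<in> J"
      have "\<ominus>\<^bsub>R\<^esub> a = - a"
        by (rule R.minus_equality) (simp_all add: R_simps)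
      with a show "\<ominus>\<^bsub>R\<^esub> a \<in> J"
        by (simp add: J_def ev_uminus)
    qed (auto simp: R_simps J_def ev_plus intro: exI[of _ 0])
  qed (auto simp: R_simps J_def ev_times ev_closed ev_null R.ring_axioms)
  moreover have "S \<subseteq> J"
    using relators by (auto simp: J_def)
  ultimately have "I \<subseteq> J"
    unfolding I_def by (rule R.genideal_minimal)
  then have ev_I: "ev p v = (\<lambda>x. 0)" if "p \<in> I" "v \<in> V" for p v
    using that by (auto simp: J_def)
  \<comment> \<open>The choice of representative does not matter on \<open>V\<close>: two
    representatives of a coset differ by an element of \<open>I\<close>, which acts as zero
    there.\<close>
  define act where "act A v = ev (SOME p. p \<in> A) v" for A v
  have act_coset: "act (I +>\<^bsub>R\<^esub> p) v = ev p v" if "v \<in> V" for p v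
  proof -
    have "p \<in> I +>\<^bsub>R\<^esub> p"
      by (rule I.a_rcos_self) (simp add: R_simps)
    then have "(SOME r. r \<in> I +>\<^bsub>R\<^esub> p) \<in> I +>\<^bsub>R\<^esub> p"
      by (rule someI)
    then obtain i where "i \<in> I" "(SOME r. r \<in> I +>\<^bsub>R\<^esub> p) = i + p"
      by (auto simp: a_r_coset_def r_coset_def R_simps)
    then show ?thesis
      using that by (simp add: act_def ev_plus ev_I)
  qed
  let ?Q = "presented_algebra S"
  have Q: "presented_algebra S =
      \<lparr> carrier = carrier (R Quot I), monoid.mult = monoid.mult (R Quot I), one = one (R Quot I),
        ring.zero = ring.zero (R Quot I), add = add (R Quot I),
        module.smult = (\<lambda>c u. (I +>\<^bsub>R\<^esub> free_const c) \<otimes>\<^bsub>R Quot I\<^esub> u) \<rparr>"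
    by (simp add: presented_algebra_def Let_def I_def R_def)
  have carr: "\<exists>p. A = I +>\<^bsub>R\<^esub> p" if "A \<in> carrier ?Q" for A
    using that by (auto simp: Q FactRing_def A_RCOSETS_def')
  have one: "\<one>\<^bsub>?Q\<^esub> = I +>\<^bsub>R\<^esub> 1"
    by (simp add: Q FactRing_def R_simps)
  have mult: "(I +>\<^bsub>R\<^esub> p) \<otimes>\<^bsub>?Q\<^esub> (I +>\<^bsub>R\<^esub> r) = I +>\<^bsub>R\<^esub> (p * r)" for p r
    using I.rcoset_mult_add[of p r] by (simp add: Q FactRing_def R_simps)
  have add: "(I +>\<^bsub>R\<^esub> p) \<oplus>\<^bsub>?Q\<^esub> (I +>\<^bsub>R\<^esub> r) = I +>\<^bsub>R\<^esub> (p + r)" for p r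
    using I.a_rcos_sum[of p r] by (simp add: Q FactRing_def R_simps)
  have smult: "c \<odot>\<^bsub>?Q\<^esub> (I +>\<^bsub>R\<^esub> p) = I +>\<^bsub>R\<^esub> (free_const c * p)" for c p
    using I.rcoset_mult_add[of "free_const c" p] by (simp add: Q FactRing_def R_simps)
  have "algebra_module ?Q V act"
    by unfold_locales
      (auto dest!: carr simp: act_coset one mult add smult V_add V_scale ev_closed ev_one ev_times
        ev_plus ev_add ev_scale ev_const)
  moreover have "presented_gen S g = I +>\<^bsub>R\<^esub> free_var g" for g
    by (simp add: presented_gen_def I_def R_def)
  ultimately show ?thesis
    using act_coset ev_var by auto
qed


subsection \<open>Counting subspaces over a finite field\<close>

locale finite_projective_geometry = finite_dimensional_vector_space smul Basis
  for smul :: "'k::{field,finite} \<Rightarrow> 'v::ab_group_add \<Rightarrow> 'v" and Basis +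
  fixes q :: nat
  assumes card_field: "CARD('k) = q"
begin

lemma q_ge_2: "q \<ge> 2"
proof -
  have "card {0, 1 :: 'k} \<le> q"
    unfolding card_field[symmetric] by (rule card_mono) auto
  then show ?thesis by simp
qed

lemma covers_iff: "covers smul y z \<longleftrightarrow> z \<subseteq> y \<and> dim y = Suc (dim z)"
  by (auto simp: covers_def)

lemma span_of_subspace [simp]: "subspace W \<Longrightarrow> span W = W"
  by simp

section \<open>The number of vectors in a subspace\<close>

text \<open>Each vector of the span is \<open>smul c a + w\<close> for exactly one pair of
  \<open>c\<close> and \<open>w \<in> W\<close>: two different scalars would put a nonzero multiple
  of \<open>a\<close>, hence \<open>a\<close> itself, into \<open>W\<close>.\<close>

lemma card_span_insert:
  assumes "subspace W" "a \<notin> W"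
  shows "card (span (insert a W)) = q * card W"
proof -
  have "bij_betw (\<lambda>(c, w). smul c a + w) ((UNIV :: 'k set) \<times> W) (span (insert a W))"
    unfolding bij_betw_def
  proof
    show "inj_on (\<lambda>(c, w). smul c a + w) ((UNIV :: 'k set) \<times> W)"
    proof (rule inj_onI, clarify)
      fix c d v w assume *: "v \<in> W" "w \<in> W" "smul c a + v = smul d a + w"
      then have "smul (c - d) a = w - v"
        by (simp add: scale_left_diff_distrib algebra_simps)
      then have "smul (c - d) a \<in> W"
        using * assms(1) subspace_diff by metis
      with assms have "c - d = 0"
        using subspace_scale[OF assms(1), of "smul (c - d) a" "inverse (c - d)"]
        by (cases "c - d = 0") auto
      with * show "c = d \<and> v = w" by simp
    qed
    have *: "x \<in> span (insert a W) \<longleftrightarrow> (\<exists>c. x - smul c a \<in> W)" for x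
      by (simp add: span_insert assms(1))
    show "(\<lambda>(c, w). smul c a + w) ` ((UNIV :: 'k set) \<times> W) = span (insert a W)"
    proof (intro equalityI subsetI)
      fix x assume "x \<in> span (insert a W)"
      then obtain c where "x - smul c a \<in> W"
        using * by blast
      moreover have "x = (\<lambda>(c, w). smul c a + w) (c, x - smul c a)"
        by simp
      ultimately show "x \<in> (\<lambda>(c, w). smul c a + w) ` ((UNIV :: 'k set) \<times> W)"
        by (metis SigmaI UNIV_I image_eqI)
    next
      fix x assume "x \<in> (\<lambda>(c, w). smul c a + w) ` ((UNIV :: 'k set) \<times> W)"
      then obtain c w where "w \<in> W" "x = smul c a + w"
        by auto
      then have "x - smul c a \<in> W"
        by simp
      then show "x \<in> span (insert a W)"
        using * by blast
    qed
  qed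
  then have "card ((UNIV :: 'k set) \<times> W) = card (span (insert a W))"
    by (rule bij_betw_same_card)
  then show ?thesis
    by (simp add: card_cartesian_product card_field)
qed

text \<open>Adjoining the vectors of a basis one at a time multiplies the cardinality by
  \<open>q\<close> at each stage.\<close>

lemma card_subspace:
  assumes "subspace W"
  shows "card W = q ^ dim W"
proof -
  obtain B where B: "B \<subseteq> W" "independent B" "W \<subseteq> span B" "card B = dim W"
    by (rule basis_exists)
  then have "finite B" "span B = W"
    using assms by (simp_all add: finiteI_independent span_subspace)
  have "card (span B) = q ^ card B"
    using \<open>finite B\<close> B(2)
  proof (induction B rule: finite_induct)
    case (insert a B)
    then have "a \<notin> span B" "independent B"
      by (simp_all add: independent_insert split: if_splits)
    have "span (insert a (span B)) = span (insert a B)"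
      by (simp add: span_insert span_span)
    with insert card_span_insert[of "span B" a] \<open>a \<notin> span B\<close> \<open>independent B\<close> show ?case
      by simp
  qed simp
  with B(4) \<open>span B = W\<close> show ?thesis by simp
qed

text \<open>\<open>card\<close> is 0 on infinite sets by default, so the positive value
  \<open>q ^ dim UNIV\<close> already forces finiteness.\<close>

lemma finite_UNIV_vectors: "finite (UNIV :: 'v set)"
proof (rule card_ge_0_finite)
  show "card (UNIV :: 'v set) > 0"
    unfolding card_subspace[OF subspace_UNIV] using q_ge_2 by simp
qed

lemma finite_vectors [simp]: "finite (W :: 'v set)"
  by (rule finite_subset[OF subset_UNIV finite_UNIV_vectors])

lemma finite_sets_of_vectors [simp]: "finite (A :: 'v set set)"
  by (rule finite_subset[OF _ finite_Pow_iff[THEN iffD2, OF finite_UNIV_vectors]]) simp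

section \<open>Covers of a subspace\<close>

text \<open>Adjoining \<open>x\<close> to \<open>w\<close> raises the dimension by one, which leaves
  no room between the span and \<open>z\<close>. Hence distinct covers of \<open>w\<close> share no
  vector outside \<open>w\<close>.\<close>

lemma cover_eq_span_insert:
  assumes "subspace z" "subspace w" "covers smul z w" "x \<in> z - w"
  shows "z = span (insert x w)"
proof -
  have "span (insert x w) \<subseteq> z"
    using assms by (intro span_minimal) (auto simp: covers_iff)
  moreover have "dim (span (insert x w)) = Suc (dim w)"
    using assms by (simp add: dim_insert)
  ultimately show ?thesis
    using subspace_dim_equal[of "span (insert x w)" z] assms by (simp add: covers_iff)
qed

text \<open>Every vector \<open>x\<close> of \<open>y - w\<close> lies in exactly one cover of
  \<open>w\<close>, namely \<open>span (insert x w)\<close>. So the sets \<open>z - w\<close>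
  partition \<open>y - w\<close>, and all of them have the same size. The product form avoids a
  division of natural numbers.\<close>

lemma card_covers_between:
  assumes "subspace w" "subspace y" "w \<subseteq> y"
  shows "card {z. subspace z \<and> covers smul z w \<and> z \<subseteq> y} * (q ^ Suc (dim w) - q ^ dim w)
    = q ^ dim y - q ^ dim w"
proof -
  let ?C = "{z. subspace z \<and> covers smul z w \<and> z \<subseteq> y}"
  have "y - w = (\<Union>z\<in>?C. z - w)"
  proof (intro equalityI subsetI)
    fix x assume x: "x \<in> y - w"
    have "w \<subseteq> span (insert x w)"
      using span_superset[of "insert x w"] by blast
    moreover have "span (insert x w) \<subseteq> y"
      using x assms by (intro span_minimal) auto
    ultimately have "span (insert x w) \<in> ?C"
      using x assms by (simp add: covers_iff dim_insert)
    moreover have "x \<in> span (insert x w)"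
      by (simp add: span_base)
    ultimately show "x \<in> (\<Union>z\<in>?C. z - w)"
      using x by blast
  qed auto
  moreover have "card (\<Union>z\<in>?C. z - w) = (\<Sum>z\<in>?C. card (z - w))"
  proof (rule card_UN_disjoint)
    show "\<forall>z\<in>?C. \<forall>z'\<in>?C. z \<noteq> z' \<longrightarrow> (z - w) \<inter> (z' - w) = {}"
    proof (intro ballI impI equals0I)
      fix z z' x assume "z \<in> ?C" "z' \<in> ?C" "z \<noteq> z'" "x \<in> (z - w) \<inter> (z' - w)"
      then show False
        using cover_eq_span_insert[OF _ assms(1)] by blast
    qed
  qed simp_all
  moreover have "card (z - w) = q ^ Suc (dim w) - q ^ dim w" if "z \<in> ?C" for z
    using that assms by (subst card_Diff_subset) (auto simp: covers_iff card_subspace)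
  moreover have "card (y - w) = q ^ dim y - q ^ dim w"
    using assms by (subst card_Diff_subset) (auto simp: card_subspace)
  ultimately show ?thesis
    by simp
qed

section \<open>Common covers and common cocovers of two subspaces\<close>

lemma dim_span_Un_Int:
  assumes "subspace y" "subspace w"
  shows "dim (span (y \<union> w)) + dim (y \<inter> w) = dim y + dim w"
proof -
  have "span (y \<union> w) = {a + b |a b. a \<in> y \<and> b \<in> w}"
    using assms by (simp add: span_Un)
  then show ?thesis
    using dim_sums_Int[OF assms] by simp
qed

lemma dim_Int_less:
  assumes "subspace y" "subspace w" "y \<noteq> w" "dim y = dim w"
  shows "dim (y \<inter> w) < dim y"
proof (rule ccontr)
  assume "\<not> ?thesis"
  then have "dim y \<le> dim (y \<inter> w)" "dim w \<le> dim (y \<inter> w)"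
    using assms by simp_all
  then have "y \<inter> w = y" "y \<inter> w = w"
    using assms(1,2) subspace_inter[OF assms(1,2)] subspace_dim_equal[of "y \<inter> w"] by blast+
  with assms show False by simp
qed

text \<open>The sum of \<open>y\<close> and \<open>w\<close> lies in \<open>z\<close>, so its
  dimension is at most \<open>dim y + 1\<close>, and the intersection has dimension at most
  \<open>dim y - 1\<close>. By the modular law the two dimensions add up to
  \<open>2 * dim y\<close>, so both bounds are attained.\<close>

lemma common_cover:
  assumes "subspace y" "subspace w" "subspace z" "y \<noteq> w" "covers smul z y" "covers smul z w"
  shows "z = span (y \<union> w)" "covers smul y (y \<inter> w)" "covers smul w (y \<inter> w)"
proof -
  have sub: "span (y \<union> w) \<subseteq> z"
    using assms by (intro span_minimal) (auto simp: covers_iff)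
  have "dim (span (y \<union> w)) \<le> dim z"
    by (rule dim_subset) (rule sub)
  moreover have "dim (y \<inter> w) < dim y"
    using assms by (intro dim_Int_less) (auto simp: covers_iff)
  ultimately have "dim (span (y \<union> w)) = dim z" "dim y = Suc (dim (y \<inter> w))"
      "dim w = Suc (dim (y \<inter> w))"
    using dim_span_Un_Int[OF assms(1,2)] assms(5,6) unfolding covers_iff by linarith+
  then show "z = span (y \<union> w)" "covers smul y (y \<inter> w)" "covers smul w (y \<inter> w)"
    using sub assms subspace_dim_equal[of "span (y \<union> w)" z] by (auto simp: covers_iff)
qed

text \<open>Dual to \<open>common_cover\<close>: the intersection contains \<open>z\<close> and is
  smaller than \<open>y\<close>, which fixes its dimension, and the modular law then fixes that of
  the sum.\<close>

lemma common_cocover: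
  assumes "subspace y" "subspace w" "subspace z" "y \<noteq> w" "covers smul y z" "covers smul w z"
  shows "z = y \<inter> w" "covers smul (span (y \<union> w)) y" "covers smul (span (y \<union> w)) w"
proof -
  have sub: "z \<subseteq> y \<inter> w"
    using assms by (auto simp: covers_iff)
  have "dim z \<le> dim (y \<inter> w)"
    by (rule dim_subset) (rule sub)
  moreover have "dim (y \<inter> w) < dim y"
    using assms by (intro dim_Int_less) (auto simp: covers_iff)
  ultimately have "dim z = dim (y \<inter> w)" "dim (span (y \<union> w)) = Suc (dim y)"
      "dim (span (y \<union> w)) = Suc (dim w)"
    using dim_span_Un_Int[OF assms(1,2)] assms(5,6) unfolding covers_iff by linarith+
  then show "z = y \<inter> w" "covers smul (span (y \<union> w)) y" "covers smul (span (y \<union> w)) w"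
    using sub assms subspace_dim_equal[of z "y \<inter> w"] span_superset[of "y \<union> w"]
    by (auto simp: covers_iff subspace_inter simp del: dim_span)
qed

text \<open>Each set has at most one element, the sum or the intersection, and by the two preceding
  lemmas an element of one yields an element of the other. This makes the off-diagonal entries of
  the commutator vanish.\<close>

lemma card_common_covers:
  assumes "subspace y" "subspace w" "y \<noteq> w"
  shows "card {z. subspace z \<and> covers smul z y \<and> covers smul z w}
    = card {z. subspace z \<and> covers smul y z \<and> covers smul w z}" (is "card ?A = card ?B")
proof -
  have "?A \<subseteq> {span (y \<union> w)}" "?B \<subseteq> {y \<inter> w}"
    using common_cover(1)[OF assms(1,2) _ assms(3)] common_cocover(1)[OF assms(1,2) _ assms(3)]
    by blast+
  moreover have "?A = {} \<longleftrightarrow> ?B = {}"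
  proof
    assume "?A = {}"
    then show "?B = {}"
      using common_cocover(2,3)[OF assms(1,2) _ assms(3)] subspace_span by blast
  next
    assume "?B = {}"
    then show "?A = {}"
      using common_cover(2,3)[OF assms(1,2) _ assms(3)] subspace_inter[OF assms(1,2)] by blast
  qed
  ultimately consider "?A = {}" "?B = {}" | "?A = {span (y \<union> w)}" "?B = {y \<inter> w}"
    by blast
  then show ?thesis
  proof cases
    case 1
    then show ?thesis by (simp only:)
  next
    case 2
    then show ?thesis by simp
  qed
qed

text \<open>Fix a hyperplane \<open>H\<close> of \<open>y\<close>. Every other hyperplane of \<open>y\<close> meets \<open>H\<close> in a hyperplane of
  \<open>H\<close>, and \<open>q\<close> of them go through a given one: the count \<open>h\<close> satisfies \<open>h (n + 1) = 1 + q * h n\<close>.\<close>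

lemma card_hyperplanes:
  assumes "subspace y"
  shows "(q - 1) * card {z. subspace z \<and> covers smul y z} = q ^ dim y - 1"
  using assms
proof (induction "dim y" arbitrary: y)
  case 0
  then show ?case
    unfolding covers_iff 0(1)[symmetric] by simp
next
  case (Suc n)
  obtain H where H: "subspace H" "H \<subseteq> y" "dim H = n"
    using choose_subspace_of_subspace[of n y] Suc by (auto simp:)
  let ?h = "\<lambda>y. {z. subspace z \<and> covers smul y z}"
  let ?C = "\<lambda>w. {z. subspace z \<and> covers smul z w \<and> z \<subseteq> y}"
  have H_in: "H \<in> ?h y"
    using H Suc by (simp add: covers_iff)
  have "?h y - {H} = (\<Union>w\<in>?h H. ?C w - {H})"
  proof (intro equalityI subsetI)
    fix z assume z: "z \<in> ?h y - {H}"
    then have "covers smul H (H \<inter> z)" "covers smul z (H \<inter> z)"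
      using common_cover(2,3)[of H z y] H_in Suc.prems by auto
    then show "z \<in> (\<Union>w\<in>?h H. ?C w - {H})"
      using z H by (auto simp: covers_iff intro!: subspace_inter exI[of _ "H \<inter> z"])
  qed (use Suc.hyps H in \<open>auto simp: covers_iff\<close>)
  \<comment> \<open>The parts are disjoint: \<open>z\<close> in the part of \<open>w\<close> forces
    \<open>w = H \<inter> z\<close>, since \<open>w\<close> is a common cocover of \<open>H\<close>
    and \<open>z\<close>.\<close>
  moreover have "card (\<Union>w\<in>?h H. ?C w - {H}) = (\<Sum>w\<in>?h H. card (?C w - {H}))"
    by (rule card_UN_disjoint) (auto dest: common_cocover(1)[OF H(1), rotated -1])
  moreover have "card (?C w - {H}) = q" if "w \<in> ?h H" for w
  proof -
    have w: "subspace w" "w \<subseteq> H" "n = Suc (dim w)"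
      using that H by (auto simp: covers_iff)
    \<comment> \<open>Here \<open>dim y = dim w + 2\<close>, so the factorization of
      \<open>q ^ 2 - 1\<close> as \<open>(q + 1) * (q - 1)\<close> yields \<open>q + 1\<close>
      intermediate subspaces. One of them is \<open>H\<close>, which leaves
      \<open>q\<close>.\<close>
    have "(q + 1) * (q ^ Suc (dim w) - q ^ dim w) = q ^ dim y - q ^ dim w"
      unfolding Suc.hyps(2)[symmetric] w(3) by (simp add: algebra_simps diff_mult_distrib)
    also have "\<dots> = card (?C w) * (q ^ Suc (dim w) - q ^ dim w)"
      using card_covers_between[of w y] w H Suc.prems by auto
    finally have "card (?C w) = q + 1 \<or> q ^ Suc (dim w) - q ^ dim w = 0"
      unfolding mult_cancel2 by (simp only: eq_commute)
    moreover have "q ^ dim w < q ^ Suc (dim w)"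
      using q_ge_2 by (intro power_strict_increasing) simp_all
    ultimately have "card (?C w) = q + 1"
      by (metis not_less_iff_gr_or_eq zero_less_diff)
    moreover have "H \<in> ?C w"
      using that H by auto
    ultimately show ?thesis
      by simp
  qed
  ultimately have "card (?h y - {H}) = card (?h H) * q"
    by simp
  then have "card (?h y) = 1 + q * card (?h H)"
    using H_in card.remove[of "?h y" H] by simp
  then have "(q - 1) * card (?h y) = (q - 1) + q * ((q - 1) * card (?h H))"
    by (simp add: algebra_simps)
  also have "\<dots> = (q - 1) + q * (q ^ n - 1)"
    using Suc.hyps(1)[of H] H by simp
  also have "\<dots> = q ^ dim y - 1"
    using q_ge_2 by (simp add: Suc.hyps(2)[symmetric] algebra_simps)
  finally show ?case .
qed

section \<open>The commutator of the two incidence operators\<close>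

text \<open>After exchanging the sums, the coefficient of \<open>f w\<close> counts the intermediate
  subspaces \<open>z\<close>; it is an entry of a product of two incidence matrices.\<close>

lemma sum_over_covers:
  "(\<Sum>z | z \<in> subspaces smul \<and> P z. \<Sum>w | w \<in> subspaces smul \<and> Q z w. f w)
    = (\<Sum>w\<in>subspaces smul. of_nat (card {z. subspace z \<and> P z \<and> Q z w}) * (f w :: complex))"
proof -
  have "(\<Sum>z | z \<in> subspaces smul \<and> P z. \<Sum>w | w \<in> subspaces smul \<and> Q z w. f w)
     = (\<Sum>w\<in>subspaces smul. \<Sum>z | z \<in> {z. z \<in> subspaces smul \<and> P z} \<and> Q z w. f w)"
    by (rule sum.swap_restrict) simp_all
  then show ?thesis
    by (simp add: subspaces_def conj_assoc)
qed

lemma up_down_commutator: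
  fixes f :: "'v set \<Rightarrow> complex"
  assumes "subspace y"
  defines "Xs \<equiv> subspaces smul"
  shows "(of_nat q - 1) *
     ((\<Sum>z | z \<in> Xs \<and> covers smul z y. \<Sum>w | w \<in> Xs \<and> covers smul z w. f w)
      - (\<Sum>z | z \<in> Xs \<and> covers smul y z. \<Sum>w | w \<in> Xs \<and> covers smul w z. f w))
    = (of_nat q ^ (dim UNIV - dim y) - of_nat q ^ dim y) * f y"
proof -
  \<comment> \<open>\<open>a w\<close> and \<open>b w\<close> are the entries at
    \<open>(y, w)\<close> of \<open>L R\<close> and \<open>R L\<close>. For \<open>w = y\<close>
    they count the covers and the hyperplanes of \<open>y\<close>.\<close>
  define a where "a w = card {z. subspace z \<and> covers smul z y \<and> covers smul z w}" for w
  define b where "b w = card {z. subspace z \<and> covers smul y z \<and> covers smul w z}" for w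
  have y: "y \<in> Xs"
    using assms by (simp add: subspaces_def)
  have dim_y: "dim y \<le> dim UNIV"
    by (rule dim_subset) simp
  have "(\<Sum>z | z \<in> Xs \<and> covers smul z y. \<Sum>w | w \<in> Xs \<and> covers smul z w. f w)
      - (\<Sum>z | z \<in> Xs \<and> covers smul y z. \<Sum>w | w \<in> Xs \<and> covers smul w z. f w)
    = (\<Sum>w\<in>Xs. (of_nat (a w) - of_nat (b w)) * f w)"
    unfolding Xs_def sum_over_covers a_def b_def by (simp add: sum_subtractf left_diff_distrib)
  also have "\<dots> = (\<Sum>w\<in>Xs. if w = y then (of_nat (a y) - of_nat (b y)) * f y else 0)"
    using card_common_covers[OF assms(1)]
    by (intro sum.cong) (auto simp: a_def b_def Xs_def subspaces_def)
  also have "\<dots> = (of_nat (a y) - of_nat (b y)) * f y"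
    using y by simp
  finally have diff: "(\<Sum>z | z \<in> Xs \<and> covers smul z y. \<Sum>w | w \<in> Xs \<and> covers smul z w. f w)
      - (\<Sum>z | z \<in> Xs \<and> covers smul y z. \<Sum>w | w \<in> Xs \<and> covers smul w z. f w)
    = (of_nat (a y) - of_nat (b y)) * f y" .
  have "a y * (q ^ Suc (dim y) - q ^ dim y) = q ^ dim UNIV - q ^ dim y"
    using card_covers_between[of y UNIV] assms(1) by (simp add: a_def)
  \<comment> \<open>Splitting off \<open>q ^ dim y\<close> prepares its cancellation;
    \<open>dim_y\<close> ensures that the subtraction in the exponent is not truncated.\<close>
  then have "a y * (q - 1) * q ^ dim y = (q ^ (dim UNIV - dim y) - 1) * q ^ dim y"
    using dim_y by (simp add: algebra_simps diff_mult_distrib flip: power_add)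
  then have "a y * (q - 1) = q ^ (dim UNIV - dim y) - 1"
    using q_ge_2 by simp
  then have "complex_of_nat (a y * (q - 1)) = of_nat (q ^ (dim UNIV - dim y) - 1)"
    by simp
  then have a: "complex_of_nat (a y) * (of_nat q - 1) = of_nat q ^ (dim UNIV - dim y) - 1"
    using q_ge_2 by (simp add: of_nat_diff)
  have "(q - 1) * b y = q ^ dim y - 1"
    using card_hyperplanes[OF assms(1)] by (simp add: b_def)
  then have "complex_of_nat ((q - 1) * b y) = of_nat (q ^ dim y - 1)"
    by simp
  then have b: "(of_nat q - 1) * complex_of_nat (b y) = of_nat q ^ dim y - 1"
    using q_ge_2 by (simp add: of_nat_diff)
  have "(of_nat q - 1) * (of_nat (a y) - of_nat (b y))
    = of_nat (a y) * (of_nat q - 1) - (of_nat q - 1) * complex_of_nat (b y)"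
    by (simp add: algebra_simps)
  also have "\<dots> = of_nat q ^ (dim UNIV - dim y) - of_nat q ^ dim y"
    unfolding a b by simp
  finally show ?thesis
    unfolding diff mult.assoc[symmetric] by (rule arg_cong)
qed

end


subsection \<open>Matrices over a finite index set\<close>

lemma carrier_Mat: "M \<in> carrier (Mat Xs) \<longleftrightarrow> (\<forall>y z. y \<notin> Xs \<or> z \<notin> Xs \<longrightarrow> M y z = 0)"
  by (simp add: Mat_def)

lemma Mat_simps:
  "\<zero>\<^bsub>Mat Xs\<^esub> = (\<lambda>y z. 0)"
  "\<one>\<^bsub>Mat Xs\<^esub> = mat_on Xs (\<lambda>y z. if y = z then 1 else 0)"
  "M \<oplus>\<^bsub>Mat Xs\<^esub> M' = (\<lambda>y z. M y z + M' y z)"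
  "M \<otimes>\<^bsub>Mat Xs\<^esub> M' = (\<lambda>y z. \<Sum>w\<in>Xs. M y w * M' w z)"
  "c \<odot>\<^bsub>Mat Xs\<^esub> M = (\<lambda>y z. c * M y z)"
  by (simp_all add: Mat_def)

text \<open>In a monoid a two-sided inverse is unique, which is how \<open>inv\<close> in
  \<open>Mat Xs\<close> gets computed.\<close>

lemma monoid_Mat:
  assumes "finite Xs"
  shows "monoid (Mat Xs)"
proof (rule monoidI)
  fix A B C assume "A \<in> carrier (Mat Xs)" "B \<in> carrier (Mat Xs)" "C \<in> carrier (Mat Xs)"
  have "(\<Sum>w\<in>Xs. (\<Sum>u\<in>Xs. A y u * B u w) * C w z) = (\<Sum>u\<in>Xs. A y u * (\<Sum>w\<in>Xs. B u w * C w z))"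
    for y z
    unfolding sum_distrib_left sum_distrib_right mult.assoc by (rule sum.swap)
  then show "A \<otimes>\<^bsub>Mat Xs\<^esub> B \<otimes>\<^bsub>Mat Xs\<^esub> C = A \<otimes>\<^bsub>Mat Xs\<^esub> (B \<otimes>\<^bsub>Mat Xs\<^esub> C)"
    by (simp add: Mat_simps)
next
  fix A assume A: "A \<in> carrier (Mat Xs)"
  have "(\<Sum>w\<in>Xs. mat_on Xs (\<lambda>y z. if y = z then 1 else 0) y w * A w z)
      = (\<Sum>w\<in>Xs. if w = y then A y z else 0)" for y z
    by (intro sum.cong) (auto simp: mat_on_def)
  then show "\<one>\<^bsub>Mat Xs\<^esub> \<otimes>\<^bsub>Mat Xs\<^esub> A = A"
    using A assms by (auto simp: Mat_simps fun_eq_iff carrier_Mat)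
  have "(\<Sum>w\<in>Xs. A y w * mat_on Xs (\<lambda>y z. if y = z then 1 else 0) w z)
      = (\<Sum>w\<in>Xs. if w = z then A y z else 0)" for y z
    by (intro sum.cong) (auto simp: mat_on_def)
  then show "A \<otimes>\<^bsub>Mat Xs\<^esub> \<one>\<^bsub>Mat Xs\<^esub> = A"
    using A assms by (auto simp: Mat_simps fun_eq_iff carrier_Mat)
qed (auto simp: Mat_simps carrier_Mat mat_on_def intro!: sum.neutral)

lemma abelian_group_Mat: "abelian_group (Mat Xs)"
proof (rule abelian_groupI)
  fix A assume "A \<in> carrier (Mat Xs)"
  then show "\<exists>B\<in>carrier (Mat Xs). B \<oplus>\<^bsub>Mat Xs\<^esub> A = \<zero>\<^bsub>Mat Xs\<^esub>"
    by (intro bexI[of _ "\<lambda>y z. - A y z"]) (auto simp: Mat_simps carrier_Mat)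
qed (auto simp: Mat_simps carrier_Mat algebra_simps)

text \<open>The difference in \<open>Mat Xs\<close> is defined through the additive inverse of the
  structure; uniqueness of inverses in an abelian group makes it the entrywise one.\<close>

lemma minus_Mat:
  assumes "A \<in> carrier (Mat Xs)" "B \<in> carrier (Mat Xs)"
  shows "A \<ominus>\<^bsub>Mat Xs\<^esub> B = (\<lambda>y z. A y z - B y z)"
proof -
  interpret abelian_group "Mat Xs" by (rule abelian_group_Mat)
  have "\<ominus>\<^bsub>Mat Xs\<^esub> B = (\<lambda>y z. - B y z)"
    by (rule minus_equality) (use assms in \<open>auto simp: Mat_simps carrier_Mat\<close>)
  then show ?thesis by (simp add: a_minus_def Mat_simps)
qed

definition diag_mat :: "'x set \<Rightarrow> ('x \<Rightarrow> complex) \<Rightarrow> 'x cmat" where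
  "diag_mat Xs d = mat_on Xs (\<lambda>y z. if y = z then d y else 0)"

lemma sum_diag_mat:
  assumes "finite Xs"
  shows "(\<Sum>w\<in>Xs. diag_mat Xs d y w * f w) = (if y \<in> Xs then d y * f y else 0)"
proof -
  have "(\<Sum>w\<in>Xs. diag_mat Xs d y w * f w) = (\<Sum>w\<in>Xs. if w = y then d y * f y else 0)"
    by (intro sum.cong) (auto simp: diag_mat_def mat_on_def)
  then show ?thesis using assms by simp
qed

text \<open>Diagonal matrices multiply entrywise along the diagonal, so inverting the entries gives
  a two-sided inverse.\<close>

lemma inv_diag_mat:
  assumes "finite Xs" and nz: "\<And>y. y \<in> Xs \<Longrightarrow> d y \<noteq> 0"
  shows "inv\<^bsub>Mat Xs\<^esub> (diag_mat Xs d) = diag_mat Xs (\<lambda>y. inverse (d y))"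
proof -
  interpret monoid "Mat Xs" by (rule monoid_Mat) fact
  have "diag_mat Xs c \<otimes>\<^bsub>Mat Xs\<^esub> diag_mat Xs c' = diag_mat Xs (\<lambda>y. c y * c' y)" for c c'
    using assms(1) by (auto simp: Mat_simps sum_diag_mat) (auto simp: diag_mat_def mat_on_def fun_eq_iff)
  moreover have "diag_mat Xs (\<lambda>y. c y) = \<one>\<^bsub>Mat Xs\<^esub>" if "\<And>y. y \<in> Xs \<Longrightarrow> c y = 1" for c
    using that by (auto simp: Mat_simps diag_mat_def mat_on_def fun_eq_iff)
  ultimately show ?thesis
    using nz by (intro inv_unique'[symmetric]) (auto simp: carrier_Mat diag_mat_def mat_on_def)
qed

lemma mat_vec_closed:
  assumes "M \<in> carrier (Mat Xs)"
  shows "mat_vec Xs M v \<in> standard_module Xs"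
  using assms by (auto simp: mat_vec_def standard_module_def carrier_Mat intro!: sum.neutral)

lemma mat_vec_smult: "mat_vec Xs (c \<odot>\<^bsub>Mat Xs\<^esub> M) v = (\<lambda>y. c * mat_vec Xs M v y)"
  by (simp add: mat_vec_def Mat_simps sum_distrib_left mult.assoc)

lemma mat_vec_add: "mat_vec Xs (M \<oplus>\<^bsub>Mat Xs\<^esub> M') v = (\<lambda>y. mat_vec Xs M v y + mat_vec Xs M' v y)"
  by (simp add: mat_vec_def Mat_simps distrib_right sum.distrib)

lemma mat_vec_minus:
  assumes "M \<in> carrier (Mat Xs)" "M' \<in> carrier (Mat Xs)"
  shows "mat_vec Xs (M \<ominus>\<^bsub>Mat Xs\<^esub> M') v = (\<lambda>y. mat_vec Xs M v y - mat_vec Xs M' v y)"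
  using assms by (simp add: mat_vec_def minus_Mat left_diff_distrib sum_subtractf)

lemma mat_vec_mult: "mat_vec Xs (M \<otimes>\<^bsub>Mat Xs\<^esub> M') v = mat_vec Xs M (mat_vec Xs M' v)"
  unfolding mat_vec_def Mat_simps sum_distrib_left sum_distrib_right mult.assoc
  by (rule ext, rule sum.swap)

lemma mat_vec_diag:
  assumes "finite Xs"
  shows "mat_vec Xs (diag_mat Xs d) v = (\<lambda>y. if y \<in> Xs then d y * v y else 0)"
  using assms by (simp add: mat_vec_def sum_diag_mat)

lemma mat_vec_incidence:
  assumes "finite Xs"
  shows "mat_vec Xs (mat_on Xs (\<lambda>y z. if P y z then 1 else 0)) v
    = (\<lambda>y. if y \<in> Xs then \<Sum>z | z \<in> Xs \<and> P y z. v z else 0)"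
  using assms by (auto simp: mat_vec_def mat_on_def fun_eq_iff sum.inter_filter intro!: sum.cong)

lemma linear_operators_mat_vec: "linear_operators (\<lambda>g. mat_vec Xs (M g))"
  by unfold_locales (simp_all add: mat_vec_def distrib_left sum.distrib sum_distrib_left mult.left_commute)


subsection \<open>Raising and lowering operators\<close>

context finite_projective_geometry
begin

text \<open>Named after the direction in which the sum looks: \<open>up\<close> is the action of the
  lowering matrix \<open>Lmat\<close>, and \<open>down\<close> that of the raising matrix
  \<open>Rmat\<close>.\<close>

definition up :: "('v set \<Rightarrow> complex) \<Rightarrow> 'v set \<Rightarrow> complex" where
  "up v y = (\<Sum>z | z \<in> subspaces smul \<and> covers smul z y. v z)"

definition down :: "('v set \<Rightarrow> complex) \<Rightarrow> 'v set \<Rightarrow> complex" where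
  "down v y = (\<Sum>z | z \<in> subspaces smul \<and> covers smul y z. v z)"

abbreviation qdim :: "'v set \<Rightarrow> complex" where
  "qdim y \<equiv> of_nat q ^ dim y"

lemma up_down: "y \<in> subspaces smul \<Longrightarrow>
    (of_nat q - 1) * (up (down v) y - down (up v) y) = (of_nat q ^ (dim UNIV - dim y) - qdim y) * v y"
  using up_down_commutator[of y v] by (simp add: up_def down_def subspaces_def)

lemma q_nonzero: "complex_of_nat q \<noteq> 0" "complex_of_nat q - 1 \<noteq> 0"
  using q_ge_2 by auto

text \<open>All covers of \<open>y\<close> have the weight \<open>q * qdim y\<close>, so the weight
  leaves the sum as a constant. The shape of \<open>w\<close> is that of \<open>TZ v\<close>
  below.\<close>

lemma up_weighted:
  assumes "\<And>z. z \<in> subspaces smul \<Longrightarrow> w z = a * (qdim z * v z) + b * u z"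
  shows "up w y = a * (of_nat q * qdim y * up v y) + b * up u y"
proof -
  have "up w y = (\<Sum>z | z \<in> subspaces smul \<and> covers smul z y. a * (of_nat q * qdim y) * v z + b * u z)"
    unfolding up_def using assms by (intro sum.cong) (auto simp: covers_iff)
  then show ?thesis
    by (simp add: up_def sum.distrib sum_distrib_left mult.assoc)
qed

lemma up_weighted_inverse:
  assumes "\<And>z. z \<in> subspaces smul \<Longrightarrow> w z = a / qdim z * v z"
  shows "up w y = a / (of_nat q * qdim y) * up v y"
proof -
  have "up w y = (\<Sum>z | z \<in> subspaces smul \<and> covers smul z y. a / (of_nat q * qdim y) * v z)"
    unfolding up_def using assms by (intro sum.cong) (auto simp: covers_iff)
  then show ?thesis
    by (simp add: up_def sum_distrib_left)
qed

text \<open>Here the weight drops by the factor \<open>q\<close>; the factor on the left-hand side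
  avoids a quotient. The shape of \<open>w\<close> is that of \<open>TX v\<close> below.\<close>

lemma down_weighted:
  assumes "\<And>z. z \<in> subspaces smul \<Longrightarrow> w z = qdim z * (a * v z + b * u z)"
  shows "of_nat q * down w y = qdim y * (a * down v y + b * down u y)"
proof -
  have "of_nat q * down w y
      = (\<Sum>z | z \<in> subspaces smul \<and> covers smul y z. qdim y * (a * v z + b * u z))"
    unfolding down_def sum_distrib_left using assms by (intro sum.cong) (auto simp: covers_iff)
  then show ?thesis
    by (simp add: down_def sum.distrib sum_distrib_left distrib_left)
qed

lemma down_weighted_inverse:
  assumes "\<And>z. z \<in> subspaces smul \<Longrightarrow> w z = a / qdim z * v z"
  shows "down w y = a * of_nat q / qdim y * down v y"
proof -
  have "down w y = (\<Sum>z | z \<in> subspaces smul \<and> covers smul y z. a * of_nat q / qdim y * v z)"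
    unfolding down_def using assms q_nonzero
    by (intro sum.cong) (auto simp: covers_iff)
  then show ?thesis
    by (simp add: down_def sum_distrib_left)
qed

end

section \<open>The three q-commutator relations\<close>

text \<open>\<open>s\<close>, \<open>t\<close> and \<open>f\<close> stand for
  \<open>q^(N/2)\<close>, \<open>q^(-N/2)\<close> and \<open>\<phi>\<close>. Of the two powers only
  \<open>s * t = 1\<close> and \<open>s * s = q^N\<close> enter, so the relations can be checked
  without square roots.\<close>

locale equitable_operators = finite_projective_geometry smul Basis q
  for smul :: "'k::{field,finite} \<Rightarrow> 'v::ab_group_add \<Rightarrow> 'v" and Basis q +
  fixes s t f :: complex
    and TX TY TZ :: "('v set \<Rightarrow> complex) \<Rightarrow> 'v set \<Rightarrow> complex"
  assumes st: "s * t = 1" and s_square: "s * s = of_nat q ^ dim UNIV" and f: "f \<noteq> 0"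
    and TX: "\<And>v y. y \<in> subspaces smul \<Longrightarrow>
      TX v y = t * (qdim y * v y - (of_nat q - 1) * f * qdim y * up v y)"
    and TY: "\<And>v y. y \<in> subspaces smul \<Longrightarrow> TY v y = s / qdim y * v y"
    and TZ: "\<And>v y. y \<in> subspaces smul \<Longrightarrow>
      TZ v y = t * (qdim y * v y + (of_nat q - 1) / f * down v y)"
begin

text \<open>The coefficient of \<open>up v\<close> in \<open>X Y\<close> is \<open>1 / q\<close>
  times the one in \<open>Y X\<close>, so the q-commutator removes it and leaves the diagonal
  part.\<close>

lemma qcomm_XY:
  assumes y: "y \<in> subspaces smul"
  shows "of_nat q * TX (TY v) y - TY (TX v) y = (of_nat q - 1) * v y"
proof -
  have "up (TY v) y = s / (of_nat q * qdim y) * up v y"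
    by (rule up_weighted_inverse) (rule TY)
  then have XY: "TX (TY v) y = (s * t) * (v y - (of_nat q - 1) * f / of_nat q * up v y)"
    using y q_nonzero by (simp add: TX TY field_simps)
  have YX: "TY (TX v) y = (s * t) * (v y - (of_nat q - 1) * f * up v y)"
    using y q_nonzero by (simp add: TX TY field_simps)
  show ?thesis
    unfolding XY YX st using q_nonzero(1) by (simp add: field_simps)
qed

text \<open>The coefficient of \<open>down v\<close> in \<open>Z Y\<close> is \<open>q\<close> times
  the one in \<open>Y Z\<close>, so these terms cancel.\<close>

lemma qcomm_YZ:
  assumes y: "y \<in> subspaces smul"
  shows "of_nat q * TY (TZ v) y - TZ (TY v) y = (of_nat q - 1) * v y"
proof -
  have "down (TY v) y = s * of_nat q / qdim y * down v y"
    by (rule down_weighted_inverse) (rule TY)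
  then have ZY: "TZ (TY v) y = (s * t) * (v y + (of_nat q - 1) / f * (of_nat q / qdim y) * down v y)"
    using y q_nonzero f by (simp add: TZ TY field_simps)
  have YZ: "TY (TZ v) y = (s * t) * (v y + (of_nat q - 1) / f * (1 / qdim y) * down v y)"
    using y q_nonzero f by (simp add: TZ TY field_simps)
  show ?thesis
    unfolding YZ ZY st using f q_nonzero(1) by (simp add: field_simps)
qed

lemma qcomm_ZX:
  assumes y: "y \<in> subspaces smul"
  shows "of_nat q * TZ (TX v) y - TX (TZ v) y = (of_nat q - 1) * v y"
proof -
  define Q where "Q = complex_of_nat q"
  define \<kappa> where "\<kappa> = Q ^ dim y"
  have down_X: "Q * down (TX v) y = \<kappa> * (t * down v y + (- t * (Q - 1) * f) * down (up v) y)"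
    unfolding Q_def \<kappa>_def by (rule down_weighted) (simp add: TX algebra_simps)
  have "Q * TZ (TX v) y = t * (Q * \<kappa> * TX v y + (Q - 1) / f * (Q * down (TX v) y))"
    using y by (simp add: TZ Q_def \<kappa>_def distrib_left mult.commute mult.left_commute)
  also have "\<dots> = t * t * (Q * \<kappa> * \<kappa> * v y - Q * (Q - 1) * f * \<kappa> * \<kappa> * up v y
      + (Q - 1) / f * \<kappa> * down v y - (Q - 1) * (Q - 1) * \<kappa> * down (up v) y)"
    unfolding down_X using y f by (simp add: TX Q_def[symmetric] \<kappa>_def[symmetric] field_simps)
  finally have ZX: "Q * TZ (TX v) y = \<dots>" .
  have up_Z: "up (TZ v) y = t * (Q * \<kappa> * up v y) + (t * (Q - 1) / f) * up (down v) y"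
    unfolding Q_def \<kappa>_def by (rule up_weighted) (simp add: TZ algebra_simps)
  have "TX (TZ v) y = t * (\<kappa> * TZ v y - (Q - 1) * f * \<kappa> * up (TZ v) y)"
    using y by (simp add: TX Q_def \<kappa>_def)
  also have "\<dots> = t * t * (\<kappa> * \<kappa> * v y + (Q - 1) / f * \<kappa> * down v y
      - Q * (Q - 1) * f * \<kappa> * \<kappa> * up v y - (Q - 1) * (Q - 1) * \<kappa> * up (down v) y)"
    unfolding up_Z using y f by (simp add: TZ Q_def[symmetric] \<kappa>_def[symmetric] field_simps)
  finally have XZ: "TX (TZ v) y = \<dots>" .
  \<comment> \<open>The terms in \<open>up v\<close> and \<open>down v\<close> agree in both
    products. The remaining \<open>\<kappa> * \<kappa>\<close> is cancelled by the hyperplane part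
    of the commutator.\<close>
  have "Q * TZ (TX v) y - TX (TZ v) y = t * t * (Q - 1) *
      (\<kappa> * \<kappa> * v y + \<kappa> * ((Q - 1) * (up (down v) y - down (up v) y)))"
    unfolding ZX XZ by (simp add: algebra_simps)
  also have "(Q - 1) * (up (down v) y - down (up v) y) = (Q ^ (dim UNIV - dim y) - \<kappa>) * v y"
    unfolding Q_def \<kappa>_def by (rule up_down[OF y])
  also have "t * t * (Q - 1) * (\<kappa> * \<kappa> * v y + \<kappa> * ((Q ^ (dim UNIV - dim y) - \<kappa>) * v y))
      = t * t * (Q - 1) * (\<kappa> * Q ^ (dim UNIV - dim y)) * v y"
    by (simp add: algebra_simps)
  \<comment> \<open>Here the dependence on \<open>y\<close> disappears: the product is
    \<open>q^N\<close>, which the two factors \<open>t\<close> normalize to 1.\<close>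
  also have "\<kappa> * Q ^ (dim UNIV - dim y) = s * s"
    unfolding \<kappa>_def Q_def s_square power_add[symmetric]
    by (simp add: dim_subset del: dim_UNIV)
  also have "t * t * (Q - 1) * (s * s) * v y = (s * t) * (s * t) * (Q - 1) * v y"
    by (simp add: algebra_simps)
  finally show ?thesis
    by (simp add: st Q_def)
qed

end

section \<open>The module structure on the standard module\<close>

text \<open>An infinite basis would have cardinality 0 by default, so a positive dimension
  guarantees a finite one.\<close>

lemma (in vector_space) finite_dimensional_if_dim_pos:
  assumes "dim UNIV > 0"
  obtains B where "finite_dimensional_vector_space scale B"
proof -
  obtain B where B: "independent B" "UNIV \<subseteq> span B" "card B = dim UNIV"
    by (rule basis_exists[of UNIV]) blast
  have "finite B"
    using assms B(3) by (intro card_ge_0_finite) simp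
  with B have "finite_dimensional_vector_space scale B"
    by unfold_locales auto
  then show ?thesis by (rule that)
qed

theorem theorem15p3:
  fixes smul :: "'k::{field,finite} \<Rightarrow> 'v::ab_group_add \<Rightarrow> 'v"
    and q N :: nat and \<phi> :: real and Xs :: "'v set set"
  assumes "primepow q" and "CARD('k) = q"
    and "N \<ge> 1"
    and "vector_space smul" and "vector_space.dim smul UNIV = N"
    and "\<phi> > 0"
    and "Xs = subspaces smul"
  shows "\<exists>act. algebra_module (Uq_sl2 (of_nat q)) (standard_module Xs) act \<and>
    (\<forall>v\<in>standard_module Xs.
      act (Uq_gen (of_nat q) GX) v =
        mat_vec Xs (((of_nat q - 1) * of_real (real q powr (- real N / 2))) \<odot>\<^bsub>Mat Xs\<^esub> Aminus smul \<phi>) v \<and>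
      act (Uq_gen (of_nat q) GY) v =
        mat_vec Xs (of_real (real q powr (real N / 2)) \<odot>\<^bsub>Mat Xs\<^esub> Astar smul) v \<and>
      act (Uq_gen (of_nat q) GYinv) v =
        mat_vec Xs (of_real (real q powr (- real N / 2)) \<odot>\<^bsub>Mat Xs\<^esub> (inv\<^bsub>Mat Xs\<^esub> (Astar smul))) v \<and>
      act (Uq_gen (of_nat q) GZ) v =
        mat_vec Xs (((of_nat q - 1) * of_real (real q powr (- real N / 2))) \<odot>\<^bsub>Mat Xs\<^esub> Aplus smul \<phi>) v)"
proof -
  interpret vector_space smul by fact
  obtain Basis where "finite_dimensional_vector_space smul Basis"
    by (rule finite_dimensional_if_dim_pos) (use assms(3,5) in simp)
  then interpret finite_dimensional_vector_space smul Basis .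
  interpret finite_projective_geometry smul Basis q
    by unfold_locales (rule assms(2))
  note Xs = \<open>Xs = subspaces smul\<close>
  have fin: "finite Xs"
    by simp
  define s where "s = complex_of_real (real q powr (real N / 2))"
  define t where "t = complex_of_real (real q powr (- real N / 2))"
  have "real q powr (real N / 2) * real q powr (- real N / 2) = 1"
    using q_ge_2 by (simp add: powr_minus)
  then have st: "s * t = 1"
    unfolding s_def t_def of_real_mult[symmetric] by simp
  have "real q powr (real N / 2) * real q powr (real N / 2) = real q ^ N"
    using q_ge_2 by (simp add: powr_realpow flip: powr_add)
  then have "s * s = of_real (real q ^ N)"
    unfolding s_def of_real_mult[symmetric] by simp
  then have ss: "s * s = of_nat q ^ dim UNIV"
    using assms(5) by simp
  have \<phi>: "complex_of_real \<phi> \<noteq> 0"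
    using assms(6) by simp

  have Astar: "Astar smul = diag_mat Xs (\<lambda>y. inverse (qdim y))"
    by (simp add: Astar_def diag_mat_def Xs card_field power_int_minus cong: if_cong)
  have invA: "inv\<^bsub>Mat Xs\<^esub> (Astar smul) = diag_mat Xs qdim"
    unfolding Astar by (subst inv_diag_mat) (use fin q_nonzero in simp_all)
  have L: "mat_vec Xs (Lmat smul) v = (\<lambda>y. if y \<in> Xs then up v y else 0)" for v
    unfolding Lmat_def up_def Xs by (rule mat_vec_incidence) simp
  have R: "mat_vec Xs (Rmat smul) v = (\<lambda>y. if y \<in> Xs then down v y else 0)" for v
    unfolding Rmat_def down_def Xs by (rule mat_vec_incidence) simp
  have mat_on_carrier: "mat_on Xs d \<in> carrier (Mat Xs)" for d
    by (auto simp: carrier_Mat mat_on_def)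
  have diag_carrier: "diag_mat Xs d \<in> carrier (Mat Xs)" for d
    by (simp add: diag_mat_def mat_on_carrier)
  have LR_carrier: "Lmat smul \<in> carrier (Mat Xs)" "Rmat smul \<in> carrier (Mat Xs)"
    by (simp_all add: Lmat_def Rmat_def mat_on_carrier flip: Xs)
  have Astar_carrier: "Astar smul \<in> carrier (Mat Xs)"
    by (simp add: Astar diag_carrier)
  have smult_carrier: "c \<odot>\<^bsub>Mat Xs\<^esub> A \<in> carrier (Mat Xs)" if "A \<in> carrier (Mat Xs)" for c A
    using that by (simp add: carrier_Mat Mat_simps)
  have KL_carrier: "diag_mat Xs qdim \<otimes>\<^bsub>Mat Xs\<^esub> Lmat smul \<in> carrier (Mat Xs)"
    by (rule monoid.m_closed[OF monoid_Mat[OF fin] diag_carrier LR_carrier(1)])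

  define M where "M g = (case g of
      GX \<Rightarrow> ((of_nat q - 1) * t) \<odot>\<^bsub>Mat Xs\<^esub> Aminus smul \<phi>
    | GY \<Rightarrow> s \<odot>\<^bsub>Mat Xs\<^esub> Astar smul
    | GYinv \<Rightarrow> t \<odot>\<^bsub>Mat Xs\<^esub> (inv\<^bsub>Mat Xs\<^esub> (Astar smul))
    | GZ \<Rightarrow> ((of_nat q - 1) * t) \<odot>\<^bsub>Mat Xs\<^esub> Aplus smul \<phi>)" for g
  define T where "T g = mat_vec Xs (M g)" for g
  interpret T: linear_operators T
    unfolding T_def by (rule linear_operators_mat_vec)

  \<comment> \<open>The factor \<open>q - 1\<close> in the prescribed image cancels the denominator
    in \<open>Aminus\<close>, which leaves the form required by
    \<open>equitable_operators\<close>.\<close>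
  have T_GX: "T GX v y = t * (qdim y * v y - (of_nat q - 1) * of_real \<phi> * qdim y * up v y)"
    if "y \<in> Xs" for v y
    using that q_nonzero(2)
    by (simp add: T_def M_def Aminus_def Let_def Xs[symmetric] invA card_field mat_vec_smult
        mat_vec_minus smult_carrier diag_carrier KL_carrier mat_vec_mult mat_vec_diag[OF fin] L
        field_simps)
  have T_GZ: "T GZ v y = t * (qdim y * v y + (of_nat q - 1) / of_real \<phi> * down v y)"
    if "y \<in> Xs" for v y
    using that q_nonzero(2) \<phi>
    by (simp add: T_def M_def Aplus_def Let_def Xs[symmetric] invA card_field mat_vec_smult
        mat_vec_add mat_vec_diag[OF fin] R field_simps)
  have T_GY: "T GY v y = s / qdim y * v y" if "y \<in> Xs" for v y
    using that by (simp add: T_def M_def Astar mat_vec_smult mat_vec_diag[OF fin] field_simps)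
  have T_GYinv: "T GYinv v y = t * qdim y * v y" if "y \<in> Xs" for v y
    using that by (simp add: T_def M_def invA mat_vec_smult mat_vec_diag[OF fin])
  interpret equitable_operators smul Basis q s t "of_real \<phi>" "T GX" "T GY" "T GZ"
    by unfold_locales (use st ss \<phi> T_GX T_GY T_GZ Xs in auto)

  have outside: "mat_vec Xs A v y = 0" if "A \<in> carrier (Mat Xs)" "y \<notin> Xs" for A v y
    using mat_vec_closed[OF that(1)] that(2) by (simp add: standard_module_def)
  have M_carrier: "M g \<in> carrier (Mat Xs)" for g
    by (cases g) (simp_all add: M_def Aminus_def Aplus_def Let_def Xs[symmetric] invA
        Astar_carrier smult_carrier diag_carrier KL_carrier LR_carrier
        abelian_monoid.a_closed[OF abelian_group.axioms(1)[OF abelian_group_Mat]]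
        abelian_group.minus_closed[OF abelian_group_Mat])
  have T_outside: "T g v y = 0" if "y \<notin> Xs" for g v y
    unfolding T_def using outside[OF M_carrier that] .

  have relators: "T.ev r v = (\<lambda>x. 0)"
    if r: "r \<in> equitable_relators (of_nat q)" and v: "v \<in> standard_module Xs" for r v
  proof
    fix y
    show "T.ev r v y = 0"
    proof (cases "y \<in> Xs")
      case False
      \<comment> \<open>Outside \<open>Xs\<close> the operators yield 0, and so does the unit term
        of each relator because \<open>v\<close> vanishes there.\<close>
      with r v show ?thesis
        by (auto simp: equitable_relators_def Let_def standard_module_def T.ev_minus T.ev_times
            T.ev_const T.ev_var T.ev_one T_outside)
    next
      case True
      \<comment> \<open>These give the two relations between \<open>GY\<close> and
        \<open>GYinv\<close>; the other three relators are the q-commutators.\<close>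
      have "T GY (T GYinv v) y = s * t * v y" "T GYinv (T GY v) y = s * t * v y"
        using True q_nonzero by (simp_all add: T_GY T_GYinv)
      with True r st q_nonzero qcomm_XY qcomm_YZ qcomm_ZX show ?thesis
        by (auto simp: equitable_relators_def Let_def T.ev_minus T.ev_times
            T.ev_const T.ev_var T.ev_one Xs)
    qed
  qed
  have "\<exists>act. algebra_module (presented_algebra (equitable_relators (of_nat q)))
        (standard_module Xs) act \<and>
      (\<forall>g. \<forall>v\<in>standard_module Xs.
        act (presented_gen (equitable_relators (of_nat q)) g) v = T g v)"
  proof (rule T.presented_algebra_module)
    show "T g v \<in> standard_module Xs" for g v
      unfolding T_def by (rule mat_vec_closed[OF M_carrier])
  qed (simp_all add: relators, simp_all add: standard_module_def)
  then obtain act where "algebra_module (Uq_sl2 (of_nat q)) (standard_module Xs) act"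
      and "\<And>g v. v \<in> standard_module Xs \<Longrightarrow> act (Uq_gen (of_nat q) g) v = T g v"
    unfolding Uq_sl2_def Uq_gen_def by blast
  then show ?thesis
    by (intro exI[of _ act]) (simp add: T_def M_def s_def t_def)
qed

end
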